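(* Let $V_1,\dots,V_t$ be finite-dimensional vector spaces over $\mathbb{F}_q$, let $T\in\bigotimes_{i=1}^tV_i$ be a tensor, and consider a decomposition $T=\sum_{j} v_{j1}\otimes\cdots\otimes v_{jt}$ of $T$ into a sum of pure tensors, with associated linear codes $C_1,\dots,C_t$. Then the tensor rank of $T$ is at least $N_q(\dim(C_i),d_i)$, for each $i\in\{1,\dots,t\}$, where $d_i$ is the minimum tensor rank of a nonzero element of the $i$-th contraction space $\mathcal{C}_i(T)$.
   Context: A pure tensor is one of the form $v_1\otimes\cdots\otimes v_t$. The tensor rank of a tensor is the minimum number of pure tensors in a decomposition of it as a sum of pure tensors. For $v^\vee\in V_i^\vee$ (dual space) the contraction of a pure tensor is $v^\vee(v_1\otimes\cdots\otimes v_t)=v^\vee(v_i)\,(v_1\otimes\cdots\otimes v_{i-1}\otimes v_{i+1}\otimes\cdots\otimes v_t)\in\bigotimes_{j\neq i}V_j$, extended linearly to all tensors. The $i$-th contraction space of $T$ is $\mathcal{C}_i(T)=\{v^\vee(T):v^\vee\in V_i^\vee\}\le\bigotimes_{j\ne i}V_j$. Given a decomposition $T=\sum_{j=1}^Rv_{j1}\otimes\cdots\otimes v_{jt}$ into the sum of $R$ pure tensors, the $i$-th associated code is $C_i=\{(v^\vee(v_{1i}),v^\vee(v_{2i}),\dots,v^\vee(v_{Ri})):v^\vee\in V_i^\vee\}\le\mathbb{F}_q^R$, i.e. the row space of the $\dim(V_i)\times R$ matrix whose columns are the coordinate vectors of $v_{1i},\dots,v_{Ri}$. It is a linear code in the Hamming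 metric, of length $R$ and dimension at most $\dim(V_i)$; it depends on the decomposition and not only on $T$. $N_q(k,d)$ denotes the length of the shortest $\mathbb{F}_q$-linear code with dimension $k$ and minimum Hamming distance $d$.
   Formalization: The decomposition is assumed to have exactly tensor-rank-many terms, or else dim(C_i) is assumed equal to the dimension of the i-th contraction space; for arbitrary redundant decompositions the claim fails, e.g. e1⊗1 = e1⊗1 + e2⊗1 + (−e2)⊗1. *)

theory Defs
  imports Main "HOL-Library.FuncSet" "HOL-Library.Function_Algebras" "HOL-Library.Extended_Nat"
begin

text \<open>Words and tensors are both scalar-valued functions, with pointwise operations.\<close>

definition fun_scale :: "'a::field \<Rightarrow> ('b \<Rightarrow> 'a) \<Rightarrow> 'b \<Rightarrow> 'a"
  where "fun_scale c f = (\<lambda>x. c * f x)"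

interpretation fun_space: vector_space fun_scale
  by standard (auto simp: fun_scale_def fun_eq_iff algebra_simps)


text \<open>
  The field of order q is a type of sort \<open>{field, finite}\<close>, and its n-dimensional coordinate space
  consists of the sequences that vanish from position n on.  Minimum distances and code lengths
  are in \<^typ>\<open>enat\<close>, so that a minimum over the empty set is \<open>\<infinity>\<close>: the zero code has minimum distance
  \<open>\<infinity>\<close>, and \<open>shortest_length\<close> is \<open>\<infinity>\<close> if there is no code with the given parameters.
\<close>

definition word_space :: "nat \<Rightarrow> (nat \<Rightarrow> 'a::field) set"
  where "word_space n = {x. \<forall>j\<ge>n. x j = 0}"

definition linear_code :: "nat \<Rightarrow> (nat \<Rightarrow> 'a::field) set \<Rightarrow> bool"
  where "linear_code n C \<longleftrightarrow> C \<subseteq> word_space n \<and> fun_space.subspace C"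

definition hamming_dist :: "nat \<Rightarrow> (nat \<Rightarrow> 'a) \<Rightarrow> (nat \<Rightarrow> 'a) \<Rightarrow> nat"
  where "hamming_dist n x y = card {j. j < n \<and> x j \<noteq> y j}"

definition min_dist :: "nat \<Rightarrow> (nat \<Rightarrow> 'a) set \<Rightarrow> enat"
  where "min_dist n C = Inf {enat (hamming_dist n x y) | x y. x \<in> C \<and> y \<in> C \<and> x \<noteq> y}"

definition shortest_length :: "'a::{field,finite} itself \<Rightarrow> nat \<Rightarrow> enat \<Rightarrow> enat"
  where "shortest_length F k d =
    Inf {enat n | n. \<exists>C :: (nat \<Rightarrow> 'a) set.
      linear_code n C \<and> fun_space.dim C = k \<and> min_dist n C = d}"


text \<open>
  The factors \<open>V k\<close> (\<open>k \<in> I\<close>) are subspaces of one ambient vector space.  Functionals on \<open>V k\<close> are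
  made unique as functions by extensionality.

  As the \<open>V k\<close> are finite-dimensional and \<open>I\<close> is finite, the tensor product is canonically isomorphic
  to the space of multilinear forms on the product of the dual spaces; \<open>v\<^sub>1 \<otimes> \<dots> \<otimes> v\<^sub>t\<close> corresponds
  to the form sending \<open>(\<phi>\<^sub>1, \<dots>, \<phi>\<^sub>t)\<close> to \<open>\<phi>\<^sub>1 v\<^sub>1 \<cdots> \<phi>\<^sub>t v\<^sub>t\<close>.  The forms are set to 0 outside
  their domain.
\<close>

definition dual_space :: "('a::field \<Rightarrow> 'v::ab_group_add \<Rightarrow> 'v) \<Rightarrow> 'v set \<Rightarrow> ('v \<Rightarrow> 'a) set"
  where "dual_space scale V = {\<phi> \<in> extensional V.
    (\<forall>x\<in>V. \<forall>y\<in>V. \<phi> (x + y) = \<phi> x + \<phi> y) \<and> (\<forall>c. \<forall>x\<in>V. \<phi> (scale c x) = c * \<phi> x)}"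

type_synonym ('a, 'v) tensor = "(nat \<Rightarrow> 'v \<Rightarrow> 'a) \<Rightarrow> 'a"

definition pure_tensor ::
    "('a::field \<Rightarrow> 'v::ab_group_add \<Rightarrow> 'v) \<Rightarrow> nat set \<Rightarrow> (nat \<Rightarrow> 'v set) \<Rightarrow> (nat \<Rightarrow> 'v) \<Rightarrow> ('a, 'v) tensor"
  where "pure_tensor scale I V v =
    (\<lambda>\<phi>. if \<phi> \<in> (\<Pi>\<^sub>E k\<in>I. dual_space scale (V k)) then \<Prod>k\<in>I. \<phi> k (v k) else 0)"

definition tensor_space ::
    "('a::field \<Rightarrow> 'v::ab_group_add \<Rightarrow> 'v) \<Rightarrow> nat set \<Rightarrow> (nat \<Rightarrow> 'v set) \<Rightarrow> ('a, 'v) tensor set"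
  where "tensor_space scale I V =
    fun_space.span {pure_tensor scale I V v | v. \<forall>k\<in>I. v k \<in> V k}"

definition pure_decomposition ::
    "('a::field \<Rightarrow> 'v::ab_group_add \<Rightarrow> 'v) \<Rightarrow> nat set \<Rightarrow> (nat \<Rightarrow> 'v set) \<Rightarrow> ('a, 'v) tensor
      \<Rightarrow> nat \<Rightarrow> (nat \<Rightarrow> nat \<Rightarrow> 'v) \<Rightarrow> bool"
  where "pure_decomposition scale I V T R v \<longleftrightarrow>
    (\<forall>j<R. \<forall>k\<in>I. v j k \<in> V k) \<and> T = (\<Sum>j<R. pure_tensor scale I V (v j))"

definition tensor_rank ::
    "('a::field \<Rightarrow> 'v::ab_group_add \<Rightarrow> 'v) \<Rightarrow> nat set \<Rightarrow> (nat \<Rightarrow> 'v set) \<Rightarrow> ('a, 'v) tensor \<Rightarrow> enat"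
  where "tensor_rank scale I V T = Inf {enat R | R. \<exists>v. pure_decomposition scale I V T R v}"

text \<open>
  In terms of multilinear forms, contraction by \<open>\<psi>\<close> in the i-th factor is insertion of \<open>\<psi>\<close> as the
  i-th argument.  The lemmas below state that this is the linear map determined by the usual
  formula on pure tensors.
\<close>

definition contract ::
    "('a::field \<Rightarrow> 'v::ab_group_add \<Rightarrow> 'v) \<Rightarrow> nat set \<Rightarrow> (nat \<Rightarrow> 'v set) \<Rightarrow> nat \<Rightarrow> ('v \<Rightarrow> 'a)
      \<Rightarrow> ('a, 'v) tensor \<Rightarrow> ('a, 'v) tensor"
  where "contract scale I V i \<psi> T =
    (\<lambda>\<phi>. if \<phi> \<in> (\<Pi>\<^sub>E k\<in>I - {i}. dual_space scale (V k)) then T (\<phi>(i := \<psi>)) else 0)"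

lemma contract_pure_tensor:
  assumes "finite I" "i \<in> I" "\<psi> \<in> dual_space scale (V i)"
  shows "contract scale I V i \<psi> (pure_tensor scale I V v) =
    fun_scale (\<psi> (v i)) (pure_tensor scale (I - {i}) V v)"
proof
  fix \<phi>
  let ?D = "\<lambda>k. dual_space scale (V k)"
  show "contract scale I V i \<psi> (pure_tensor scale I V v) \<phi> =
    fun_scale (\<psi> (v i)) (pure_tensor scale (I - {i}) V v) \<phi>"
  proof (cases "\<phi> \<in> (\<Pi>\<^sub>E k\<in>I - {i}. ?D k)")
    case True
    have "\<phi>(i := \<psi>) \<in> (\<Pi>\<^sub>E k\<in>insert i (I - {i}). ?D k)"
      using PiE_fun_upd[of \<psi> ?D i \<phi> "I - {i}"] True assms(3) by simp
    then have "\<phi>(i := \<psi>) \<in> (\<Pi>\<^sub>E k\<in>I. ?D k)"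
      using assms(2) by (simp add: insert_absorb)
    moreover have "(\<Prod>k\<in>I. (\<phi>(i := \<psi>)) k (v k)) = \<psi> (v i) * (\<Prod>k\<in>I - {i}. \<phi> k (v k))"
      using assms(1,2) by (simp add: prod.remove)
    ultimately show ?thesis
      using True by (simp add: contract_def pure_tensor_def fun_scale_def)
  qed (simp add: contract_def pure_tensor_def fun_scale_def)
qed

lemma contract_add: "contract scale I V i \<psi> (S + T) = contract scale I V i \<psi> S + contract scale I V i \<psi> T"
  by (auto simp: contract_def)

lemma contract_scale: "contract scale I V i \<psi> (fun_scale c T) = fun_scale c (contract scale I V i \<psi> T)"
  by (auto simp: contract_def fun_scale_def)

definition contraction_space ::
    "('a::field \<Rightarrow> 'v::ab_group_add \<Rightarrow> 'v) \<Rightarrow> nat set \<Rightarrow> (nat \<Rightarrow> 'v set) \<Rightarrow> nat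
      \<Rightarrow> ('a, 'v) tensor \<Rightarrow> ('a, 'v) tensor set"
  where "contraction_space scale I V i T =
    {contract scale I V i \<psi> T | \<psi>. \<psi> \<in> dual_space scale (V i)}"

definition min_contraction_rank ::
    "('a::field \<Rightarrow> 'v::ab_group_add \<Rightarrow> 'v) \<Rightarrow> nat set \<Rightarrow> (nat \<Rightarrow> 'v set) \<Rightarrow> nat
      \<Rightarrow> ('a, 'v) tensor \<Rightarrow> enat"
  where "min_contraction_rank scale I V i T =
    Inf {tensor_rank scale (I - {i}) V S | S. S \<in> contraction_space scale I V i T \<and> S \<noteq> 0}"

definition associated_code ::
    "('a::field \<Rightarrow> 'v::ab_group_add \<Rightarrow> 'v) \<Rightarrow> (nat \<Rightarrow> 'v set) \<Rightarrow> nat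
      \<Rightarrow> nat \<Rightarrow> (nat \<Rightarrow> nat \<Rightarrow> 'v) \<Rightarrow> (nat \<Rightarrow> 'a) set"
  where "associated_code scale V i R v =
    {(\<lambda>j. if j < R then \<psi> (v j i) else 0) | \<psi>. \<psi> \<in> dual_space scale (V i)}"

end

theory Submission imports Defs begin

text \<open>
  Take a decomposition of minimal length \<open>R\<close>.  By minimality, contraction by \<open>\<psi>\<close> vanishes only if
  the codeword of \<open>\<psi>\<close> does: otherwise one of the contracted pure tensors is a combination of the
  others, and substituting it gives a decomposition of length \<open>R - 1\<close>.  So the code is isomorphic to
  the contraction space, and a codeword of weight \<open>w\<close> corresponds to a contraction of rank at
  most \<open>w\<close>.  Hence the minimum distance is at least \<open>d\<^sub>i\<close>, and puncturing lowers it to exactly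
  \<open>d\<^sub>i\<close> without changing the dimension.
\<close>

section \<open>Preliminaries on dimensions and infima\<close>

text \<open>Injectivity is asked on \<open>S\<close> only: puncturing and the map from codewords to
  contractions both have kernels in the full space of sequences.\<close>

lemma (in Vector_Spaces.linear) dim_image_inj_on:
  assumes S: "vs1.subspace S" and inj: "inj_on f S"
  shows "vs2.dim (f ` S) = vs1.dim S"
proof -
  obtain B where B: "B \<subseteq> S" "vs1.independent B" "S \<subseteq> vs1.span B" "card B = vs1.dim S"
    by (rule vs1.basis_exists)
  have span: "vs1.span B = S"
    using B S vs1.span_minimal by blast
  have "vs2.independent (f ` B)"
    using B(2) inj span by (intro independent_injective_image) auto
  moreover have "vs2.span (f ` B) = vs2.span (f ` S)"
    by (metis span span_image vs1.span_span)
  ultimately have "vs2.dim (f ` S) = card (f ` B)"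
    using vs2.dim_eq_card by metis
  also have "\<dots> = card B"
    using inj B(1) by (intro card_image) (rule inj_on_subset)
  finally show ?thesis
    using B(4) by simp
qed

lemma sum_fun_apply: "(\<Sum>j\<in>J. f j) x = (\<Sum>j\<in>J. f j x)"
  by (induction J rule: infinite_finite_induct) auto

lemma Inf_enat_mem:
  fixes A :: "enat set"
  assumes "A \<noteq> {}"
  shows "Inf A \<in> A"
  using assms LeastI_ex[of "\<lambda>x. x \<in> A"] by (auto simp: Inf_enat_def)

section \<open>Minimum distance and puncturing\<close>

lemma hamming_dist_diff:
  fixes x y :: "nat \<Rightarrow> 'a::ab_group_add"
  shows "hamming_dist n (x - y) 0 = hamming_dist n x y"
  by (simp add: hamming_dist_def)

lemma min_dist_le_hamming_dist:
  assumes "x \<in> C" "y \<in> C" "x \<noteq> y"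
  shows "min_dist n C \<le> enat (hamming_dist n x y)"
  unfolding min_dist_def using assms by (intro Inf_lower) auto

lemma le_min_dist:
  assumes C: "fun_space.subspace C"
    and le: "\<And>x. x \<in> C \<Longrightarrow> x \<noteq> 0 \<Longrightarrow> d \<le> enat (hamming_dist n x 0)"
  shows "d \<le> min_dist n C"
  unfolding min_dist_def
proof (rule Inf_greatest)
  fix e
  assume "e \<in> {enat (hamming_dist n x y) | x y. x \<in> C \<and> y \<in> C \<and> x \<noteq> y}"
  then obtain x y where "e = enat (hamming_dist n x y)" "x \<in> C" "y \<in> C" "x \<noteq> y"
    by auto
  then show "d \<le> e"
    using le[of "x - y"] fun_space.subspace_diff[OF C] by (simp add: hamming_dist_diff)
qed

text \<open>Puncture at a position where some closest pair differs: that pair drops to distance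
  \<open>m\<close>, while every other distance drops by at most one. The entry is set to 0 rather
  than deleted, so the length remains \<open>n\<close>.\<close>

lemma puncture_code:
  fixes C :: "(nat \<Rightarrow> 'a::field) set"
  assumes C: "linear_code n C" and dist: "min_dist n C = enat (Suc m)" and "m \<noteq> 0"
  shows "\<exists>D :: (nat \<Rightarrow> 'a) set. linear_code n D \<and> fun_space.dim D = fun_space.dim C \<and> min_dist n D = enat m"
proof -
  let ?A = "{enat (hamming_dist n x y) | x y. x \<in> C \<and> y \<in> C \<and> x \<noteq> y}"
  have "?A \<noteq> {}"
    using dist unfolding min_dist_def by (metis Inf_empty enat.distinct(1) infinity_enat_def top_enat_def)
  then have "enat (Suc m) \<in> ?A"
    using Inf_enat_mem[of ?A] dist unfolding min_dist_def by simp
  then obtain x y where xy: "x \<in> C" "y \<in> C" "x \<noteq> y" "hamming_dist n x y = Suc m"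
    by auto
  then have "{j. j < n \<and> x j \<noteq> y j} \<noteq> {}"
    unfolding hamming_dist_def by (metis card.empty nat.distinct(1))
  then obtain p where p: "p < n" "x p \<noteq> y p"
    by auto
  define f :: "(nat \<Rightarrow> 'a) \<Rightarrow> nat \<Rightarrow> 'a" where "f u = u(p := 0)" for u
  interpret f: Vector_Spaces.linear fun_scale fun_scale f
    by unfold_locales (auto simp: f_def fun_scale_def fun_eq_iff)
  have diff: "{j. j < n \<and> f u j \<noteq> f w j} = {j. j < n \<and> u j \<noteq> w j} - {p}" for u w
    by (auto simp: f_def)
  have dist_f: "hamming_dist n u w \<le> Suc (hamming_dist n (f u) (f w))" for u w
    unfolding hamming_dist_def diff by (auto simp: card_Diff_singleton_if)
  have sub: "fun_space.subspace C" and sub_word: "C \<subseteq> word_space n"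
    using C by (auto simp: linear_code_def)
  have far: "m \<le> hamming_dist n (f u) (f w)" if "u \<in> C" "w \<in> C" "u \<noteq> w" for u w
    using min_dist_le_hamming_dist[OF that, of n] dist_f[of u w] dist by simp
  \<comment> \<open>Distinct codewords with equal images would have images at distance 0, below the
    positive bound \<open>m\<close> of \<open>far\<close>.\<close>
  have inj: "inj_on f C"
  proof (rule inj_onI, rule ccontr)
    fix u w assume "u \<in> C" "w \<in> C" "f u = f w" "u \<noteq> w"
    with far[of u w] \<open>m \<noteq> 0\<close> show False
      by (simp add: hamming_dist_def)
  qed
  have "f x \<noteq> f y"
    using inj xy by (auto dest: inj_onD)
  moreover have "hamming_dist n (f x) (f y) = m"
    using p xy(4) unfolding hamming_dist_def diff by (subst card_Diff_singleton) auto
  ultimately have "min_dist n (f ` C) \<le> enat m"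
    using min_dist_le_hamming_dist[of "f x" "f ` C" "f y" n] xy by simp
  moreover have "enat m \<le> min_dist n (f ` C)"
    unfolding min_dist_def using far by (intro Inf_greatest) (clarsimp, metis)
  moreover have "linear_code n (f ` C)"
    using f.subspace_image[OF sub] sub_word by (auto simp: linear_code_def word_space_def f_def)
  ultimately show ?thesis
    using f.dim_image_inj_on[OF sub inj] by (intro exI[of _ "f ` C"]) auto
qed

lemma code_with_smaller_min_dist:
  fixes C :: "(nat \<Rightarrow> 'a::field) set"
  assumes "linear_code n C" "min_dist n C = enat (m + e)" "m \<noteq> 0"
  shows "\<exists>D :: (nat \<Rightarrow> 'a) set. linear_code n D \<and> fun_space.dim D = fun_space.dim C \<and> min_dist n D = enat m"
  using assms
proof (induction e arbitrary: C)
  case 0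
  then show ?case by auto
next
  case (Suc e)
  then obtain C' :: "(nat \<Rightarrow> 'a) set" where "linear_code n C'" "fun_space.dim C' = fun_space.dim C"
      "min_dist n C' = enat (m + e)"
    using puncture_code[of n C "m + e"] by auto
  with Suc.IH[of C'] Suc.prems(3) show ?case by simp
qed

text \<open>\<open>shortest_length\<close> asks for minimum distance exactly \<open>d\<close>, so a
  code that is too good has to be punctured. A code of minimum distance \<infinity> has no two
  distinct words and puncturing cannot make its distance finite; hence the last assumption.\<close>

lemma shortest_length_le:
  fixes C :: "(nat \<Rightarrow> 'a::{field,finite}) set"
  assumes C: "linear_code n C" and "d \<noteq> 0" and le: "d \<le> min_dist n C"
    and inf: "min_dist n C = \<infinity> \<Longrightarrow> d = \<infinity>"
  shows "shortest_length TYPE('a) (fun_space.dim C) d \<le> enat n"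
proof -
  have "\<exists>D :: (nat \<Rightarrow> 'a) set. linear_code n D \<and> fun_space.dim D = fun_space.dim C \<and> min_dist n D = d"
  proof (cases "min_dist n C")
    case (enat m)
    with le obtain d' where d': "d = enat d'" "d' \<le> m"
      by (cases d) auto
    then have "min_dist n C = enat (d' + (m - d'))" "d' \<noteq> 0"
      using enat \<open>d \<noteq> 0\<close> by (auto simp: zero_enat_def)
    from code_with_smaller_min_dist[OF C this] show ?thesis
      unfolding d'(1) .
  qed (use C inf in auto)
  then show ?thesis
    unfolding shortest_length_def by (intro Inf_lower) auto
qed

section \<open>Contractions and rank of sums of pure tensors\<close>

lemma contract_sum:
  "contract scale I V i \<psi> (\<Sum>j\<in>J. f j) = (\<Sum>j\<in>J. contract scale I V i \<psi> (f j))"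
proof (induction J rule: infinite_finite_induct)
  case (insert j J)
  then show ?case by (simp only: sum.insert contract_add not_False_eq_True)
qed (auto simp: contract_def)

lemma contract_pure_sum:
  assumes "finite I" "i \<in> I" "\<psi> \<in> dual_space scale (V i)"
  shows "contract scale I V i \<psi> (\<Sum>j\<in>J. pure_tensor scale I V (v j)) =
    (\<Sum>j\<in>J. fun_scale (\<psi> (v j i)) (pure_tensor scale (I - {i}) V (v j)))"
  using assms by (simp add: contract_sum contract_pure_tensor)

text \<open>An arbitrary finite index set allows summands to be dropped from \<open>{..<R}\<close>
  without renumbering at each use.\<close>

lemma tensor_rank_le_card:
  assumes "finite J" "\<And>j k. j \<in> J \<Longrightarrow> k \<in> I \<Longrightarrow> w j k \<in> V k"
  shows "tensor_rank scale I V (\<Sum>j\<in>J. pure_tensor scale I V (w j)) \<le> enat (card J)"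
proof -
  obtain h where h: "bij_betw h {..<card J} J"
    using ex_bij_betw_nat_finite[OF assms(1)] by (auto simp: atLeast0LessThan)
  have "(\<Sum>j<card J. pure_tensor scale I V (w (h j))) = (\<Sum>j\<in>J. pure_tensor scale I V (w j))"
    by (rule sum.reindex_bij_betw[OF h])
  then have "pure_decomposition scale I V (\<Sum>j\<in>J. pure_tensor scale I V (w j)) (card J) (\<lambda>j. w (h j))"
    using assms(2) bij_betwE[OF h] by (auto simp: pure_decomposition_def)
  then show ?thesis
    unfolding tensor_rank_def by (intro Inf_lower) auto
qed

lemma tensor_rank_attained:
  assumes "pure_decomposition scale I V T R v"
  obtains R' v' where "enat R' = tensor_rank scale I V T" "pure_decomposition scale I V T R' v'"
proof -
  let ?A = "{enat R | R. \<exists>v. pure_decomposition scale I V T R v}"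
  have "?A \<noteq> {}"
    using assms by auto
  then have "tensor_rank scale I V T \<in> ?A"
    unfolding tensor_rank_def by (rule Inf_enat_mem)
  then show ?thesis
    using that by auto
qed

lemma tensor_rank_eq_0D:
  assumes "tensor_rank scale I V T = 0"
  shows "T = 0"
proof -
  let ?A = "{enat R | R. \<exists>v. pure_decomposition scale I V T R v}"
  have "?A \<noteq> {}"
    using assms unfolding tensor_rank_def by (metis Inf_empty infinity_ne_i0 top_enat_def)
  then have "0 \<in> ?A"
    using Inf_enat_mem[of ?A] assms unfolding tensor_rank_def by simp
  then show ?thesis
    by (auto simp: pure_decomposition_def zero_enat_def)
qed

text \<open>An infimum 0 in \<open>enat\<close> would be attained by a nonzero contraction of rank
  0, which is an empty sum. Positivity is what keeps puncturing injective down to this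
  distance.\<close>

lemma min_contraction_rank_nonzero: "min_contraction_rank scale I V i T \<noteq> 0"
proof
  let ?A = "{tensor_rank scale (I - {i}) V S | S. S \<in> contraction_space scale I V i T \<and> S \<noteq> 0}"
  assume "min_contraction_rank scale I V i T = 0"
  then have Inf0: "Inf ?A = 0"
    by (simp add: min_contraction_rank_def)
  then have "?A \<noteq> {}"
    by (metis Inf_empty infinity_ne_i0 top_enat_def)
  then have "0 \<in> ?A"
    using Inf_enat_mem[of ?A] Inf0 by simp
  then show False
    using tensor_rank_eq_0D by force
qed

lemma min_contraction_rank_le:
  assumes "\<psi> \<in> dual_space scale (V i)" "contract scale I V i \<psi> T \<noteq> 0"
  shows "min_contraction_rank scale I V i T \<le> tensor_rank scale (I - {i}) V (contract scale I V i \<psi> T)"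
  unfolding min_contraction_rank_def contraction_space_def using assms by (intro Inf_lower) auto

section \<open>The associated code as an image of the dual space\<close>

definition codeword :: "nat \<Rightarrow> nat \<Rightarrow> (nat \<Rightarrow> nat \<Rightarrow> 'v) \<Rightarrow> ('v \<Rightarrow> 'a) \<Rightarrow> nat \<Rightarrow> 'a::field"
  where "codeword i R v \<psi> = (\<lambda>j. if j < R then \<psi> (v j i) else 0)"

lemma associated_code_eq: "associated_code scale V i R v = codeword i R v ` dual_space scale (V i)"
  by (auto simp: associated_code_def codeword_def)

context vector_space
begin

lemma dual_space_combination:
  assumes "subspace W" "\<psi> \<in> dual_space scale W" "\<chi> \<in> dual_space scale W"
  shows "restrict (\<lambda>x. a * \<psi> x + b * \<chi> x) W \<in> dual_space scale W"
  using assms by (auto simp: dual_space_def subspace_add subspace_scale algebra_simps)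

lemma zero_in_dual_space:
  assumes "subspace W"
  shows "restrict (\<lambda>x. 0) W \<in> dual_space scale W"
  using assms by (auto simp: dual_space_def subspace_add subspace_scale)

lemma linear_code_associated_code:
  assumes W: "subspace (V i)" and v: "\<And>j. j < R \<Longrightarrow> v j i \<in> V i"
  shows "linear_code R (associated_code scale V i R v)"
proof -
  let ?D = "dual_space scale (V i)"
  have comb: "fun_scale a (codeword i R v \<psi>) + fun_scale b (codeword i R v \<chi>)
      \<in> codeword i R v ` ?D" if "\<psi> \<in> ?D" "\<chi> \<in> ?D" for a b \<psi> \<chi>
    using dual_space_combination[OF W that, of a b] v
    by (intro image_eqI[of _ _ "restrict (\<lambda>x. a * \<psi> x + b * \<chi> x) (V i)"])
      (auto simp: codeword_def fun_scale_def fun_eq_iff)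
  have "fun_space.subspace (codeword i R v ` ?D)"
    unfolding fun_space.subspace_def
  proof (intro conjI ballI allI)
    show "0 \<in> codeword i R v ` ?D"
      using zero_in_dual_space[OF W] v
      by (intro image_eqI[of _ _ "restrict (\<lambda>x. 0) (V i)"]) (auto simp: codeword_def fun_eq_iff)
    show "x + y \<in> codeword i R v ` ?D" if "x \<in> codeword i R v ` ?D" "y \<in> codeword i R v ` ?D" for x y
      using comb[of _ _ 1 1] that by auto
    show "fun_scale c x \<in> codeword i R v ` ?D" if "x \<in> codeword i R v ` ?D" for c x
      using comb[of _ _ c 0] that by auto
  qed
  then show ?thesis
    unfolding linear_code_def associated_code_eq by (auto simp: codeword_def word_space_def)
qed

section \<open>Ranks of contractions and weights of codewords\<close>

text \<open>Each coefficient is absorbed into the vector in one fixed factor \<open>k\<close>; this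
  is where a factor must exist.\<close>

lemma tensor_rank_combination_le:
  assumes I: "finite I" "I \<noteq> {}" and V: "\<And>k. k \<in> I \<Longrightarrow> subspace (V k)"
    and J: "finite J" and v: "\<And>j k. j \<in> J \<Longrightarrow> k \<in> I \<Longrightarrow> v j k \<in> V k"
  shows "tensor_rank scale I V (\<Sum>j\<in>J. fun_scale (c j) (pure_tensor scale I V (v j)))
    \<le> enat (card J)"
proof -
  obtain k where k: "k \<in> I"
    using I(2) by auto
  define w where "w j = (v j)(k := scale (c j) (v j k))" for j
  have "fun_scale (c j) (pure_tensor scale I V (v j)) = pure_tensor scale I V (w j)" if "j \<in> J" for j
  proof
    fix \<phi>
    show "fun_scale (c j) (pure_tensor scale I V (v j)) \<phi> = pure_tensor scale I V (w j) \<phi>"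
    proof (cases "\<phi> \<in> (\<Pi>\<^sub>E k\<in>I. dual_space scale (V k))")
      case True
      then have "\<phi> k \<in> dual_space scale (V k)"
        using k by auto
      then have "\<phi> k (scale (c j) (v j k)) = c j * \<phi> k (v j k)"
        using v[OF that k] by (simp add: dual_space_def)
      moreover have "(\<Prod>l\<in>I - {k}. \<phi> l (w j l)) = (\<Prod>l\<in>I - {k}. \<phi> l (v j l))"
        by (rule prod.cong) (auto simp: w_def)
      ultimately have "(\<Prod>l\<in>I. \<phi> l (w j l)) = c j * (\<Prod>l\<in>I. \<phi> l (v j l))"
        using I k by (simp add: prod.remove[of I k] w_def)
      then show ?thesis
        using True by (simp add: pure_tensor_def fun_scale_def)
    qed (simp add: pure_tensor_def fun_scale_def)
  qed
  then have eq: "(\<Sum>j\<in>J. fun_scale (c j) (pure_tensor scale I V (v j))) =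
      (\<Sum>j\<in>J. pure_tensor scale I V (w j))"
    by (rule sum.cong[OF refl])
  have "w j l \<in> V l" if "j \<in> J" "l \<in> I" for j l
    using v[OF that] V[OF that(2)] by (auto simp: w_def subspace_scale)
  then show ?thesis
    unfolding eq using J by (intro tensor_rank_le_card)
qed

text \<open>
  The empty product of spaces needs care: its only pure tensor is 1, so the rank of a scalar
  can exceed 1 or be \<open>\<infinity>\<close>.
\<close>

lemma min_contraction_rank_singleton_le_1:
  assumes W: "subspace (V i)" and \<psi>: "\<psi> \<in> dual_space scale (V i)"
    and nz: "contract scale {i} V i \<psi> (\<Sum>j\<in>J. pure_tensor scale {i} V (v j)) \<noteq> 0"
      (is "contract _ _ _ _ _ ?T \<noteq> 0")
    and v: "\<And>j. j \<in> J \<Longrightarrow> v j i \<in> V i"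
  shows "min_contraction_rank scale {i} V i ?T \<le> 1"
proof -
  let ?p = "\<lambda>j. pure_tensor scale {} V (v j)"
  define s where "s = (\<Sum>j\<in>J. \<psi> (v j i))"
  have p: "?p j = pure_tensor scale {} V u" for j u
    by (auto simp: pure_tensor_def)
  \<comment> \<open>All pure tensors over the empty index set coincide, so every contraction is a
    multiple of one of them and \<open>u\<close> is arbitrary.\<close>
  have contract: "contract scale {i} V i \<chi> ?T = fun_scale (\<Sum>j\<in>J. \<chi> (v j i)) (pure_tensor scale {} V u)"
    if "\<chi> \<in> dual_space scale (V i)" for \<chi> u
    using contract_pure_sum[of "{i}" i \<chi> scale V v J] that p[of _ u]
    by (simp add: fun_space.scale_sum_left)
  have "s \<noteq> 0"
    using nz contract[OF \<psi>] by (auto simp: s_def)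
  \<comment> \<open>Dividing \<psi> by \<open>s\<close> turns the contraction into the scalar 1, a
    single pure tensor. The term with coefficient 0 only fits the shape of
    \<open>dual_space_combination\<close>.\<close>
  define \<chi> where "\<chi> = restrict (\<lambda>x. inverse s * \<psi> x + 0 * \<psi> x) (V i)"
  have \<chi>: "\<chi> \<in> dual_space scale (V i)"
    unfolding \<chi>_def by (rule dual_space_combination[OF W \<psi> \<psi>])
  have "(\<Sum>j\<in>J. \<chi> (v j i)) = (\<Sum>j\<in>J. inverse s * \<psi> (v j i))"
    by (rule sum.cong) (auto simp: \<chi>_def v)
  also have "\<dots> = inverse s * s"
    by (simp only: s_def sum_distrib_left)
  finally have one: "contract scale {i} V i \<chi> ?T = pure_tensor scale {} V u" for u
    using contract[OF \<chi>, of u] \<open>s \<noteq> 0\<close> by simp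
  \<comment> \<open>The constant \<open>undefined\<close> function is the only element of the empty
    extensional product; the form takes the empty product 1 there.\<close>
  have "pure_tensor scale {} V u (\<lambda>_. undefined) \<noteq> 0" for u
    by (simp add: pure_tensor_def)
  then have "contract scale {i} V i \<chi> ?T \<noteq> 0"
    using one by (metis zero_fun_apply)
  with \<chi> have "min_contraction_rank scale {i} V i ?T \<le>
      tensor_rank scale ({i} - {i}) V (contract scale {i} V i \<chi> ?T)"
    by (rule min_contraction_rank_le)
  also have "\<dots> \<le> enat (card {0::nat})"
    using tensor_rank_le_card[of "{0::nat}" "{}" "\<lambda>_ _. 0" V scale] one[of "\<lambda>_. 0"] by simp
  finally show ?thesis
    by (simp add: one_enat_def)
qed

text \<open>Only the summands in the support \<open>J\<close> of the codeword survive contraction,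
  and their coefficients are absorbed into a remaining factor. If \<open>I = {i}\<close> no factor
  remains; then the bound 1 suffices, since \<open>J\<close> is nonempty.\<close>

lemma min_contraction_rank_le_weight:
  assumes I: "finite I" "i \<in> I" and V: "\<And>k. k \<in> I \<Longrightarrow> subspace (V k)"
    and dec: "pure_decomposition scale I V T R v"
    and \<psi>: "\<psi> \<in> dual_space scale (V i)" and nz: "contract scale I V i \<psi> T \<noteq> 0"
  shows "min_contraction_rank scale I V i T \<le> enat (hamming_dist R (codeword i R v \<psi>) 0)"
proof -
  define J where "J = {j. j < R \<and> \<psi> (v j i) \<noteq> 0}"
  have T: "T = (\<Sum>j<R. pure_tensor scale I V (v j))" and v: "\<And>j k. j < R \<Longrightarrow> k \<in> I \<Longrightarrow> v j k \<in> V k"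
    using dec by (auto simp: pure_decomposition_def)
  have weight: "hamming_dist R (codeword i R v \<psi>) 0 = card J"
    unfolding hamming_dist_def J_def by (rule arg_cong[of _ _ card]) (auto simp: codeword_def)
  have "contract scale I V i \<psi> T =
      (\<Sum>j<R. fun_scale (\<psi> (v j i)) (pure_tensor scale (I - {i}) V (v j)))"
    unfolding T using I \<psi> by (rule contract_pure_sum)
  also have "\<dots> = (\<Sum>j\<in>J. fun_scale (\<psi> (v j i)) (pure_tensor scale (I - {i}) V (v j)))"
    by (rule sum.mono_neutral_right) (auto simp: J_def)
  finally have contract: "contract scale I V i \<psi> T =
      (\<Sum>j\<in>J. fun_scale (\<psi> (v j i)) (pure_tensor scale (I - {i}) V (v j)))" .
  have J: "finite J"
    by (simp add: J_def)
  show ?thesis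
  proof (cases "I = {i}")
    case True
    have "min_contraction_rank scale I V i T \<le> 1"
      using min_contraction_rank_singleton_le_1[of V i \<psi> v "{..<R}"] V I \<psi> nz v True
      by (simp add: T)
    moreover have "J \<noteq> {}"
      using contract nz by auto
    then have "1 \<le> card J"
      using J by (simp add: Suc_le_eq card_gt_0_iff)
    ultimately show ?thesis
      unfolding weight by (metis enat_ord_simps(1) one_enat_def order_trans)
  next
    case False
    then have "I - {i} \<noteq> {}"
      using I by auto
    then have "tensor_rank scale (I - {i}) V (contract scale I V i \<psi> T) \<le> enat (card J)"
      unfolding contract using I V v J
      by (intro tensor_rank_combination_le) (auto simp: J_def)
    then show ?thesis
      unfolding weight using min_contraction_rank_le[OF \<psi> nz] by (rule order_trans[rotated])
  qed
qed

section \<open>Decompositions of minimal length\<close>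

lemma minimal_decomposition_contract_eq_0:
  assumes I: "finite I" "i \<in> I" and V: "subspace (V i)"
    and dec: "pure_decomposition scale I V T R v" and R: "enat R = tensor_rank scale I V T"
    and \<psi>: "\<psi> \<in> dual_space scale (V i)" and zero: "contract scale I V i \<psi> T = 0"
  shows "codeword i R v \<psi> = 0"
proof (rule ccontr)
  assume "codeword i R v \<psi> \<noteq> 0"
  then obtain p where p: "p < R" "\<psi> (v p i) \<noteq> 0"
    by (auto simp: codeword_def fun_eq_iff split: if_splits)
  have T: "T = (\<Sum>j<R. pure_tensor scale I V (v j))" and v: "\<And>j k. j < R \<Longrightarrow> k \<in> I \<Longrightarrow> v j k \<in> V k"
    using dec by (auto simp: pure_decomposition_def)
  \<comment> \<open>Vanishing of the contraction makes the \<open>p\<close>-th contracted pure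
    tensor the combination of the others with coefficients \<open>a j\<close>. Substituting it into
    the \<open>p\<close>-th summand of \<open>T\<close> adds \<open>a j\<close> times
    \<open>v p i\<close> to the \<open>i\<close>-th vector of each other summand.\<close>
  define a where "a j = - (\<psi> (v j i) / \<psi> (v p i))" for j
  define w where "w j = (v j)(i := v j i + scale (a j) (v p i))" for j
  let ?D = "\<Pi>\<^sub>E k\<in>I. dual_space scale (V k)"
  have "T = (\<Sum>j\<in>{..<R} - {p}. pure_tensor scale I V (w j))"
  proof
    fix \<phi>
    show "T \<phi> = (\<Sum>j\<in>{..<R} - {p}. pure_tensor scale I V (w j)) \<phi>"
    proof (cases "\<phi> \<in> ?D")
      case True
      \<comment> \<open>\<open>P j\<close> is the value of the \<open>j\<close>-th contracted pure
        tensor. It is the same for \<open>w j\<close>, which differs from \<open>v j\<close> only in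
        factor \<open>i\<close>.\<close>
      define P where "P j = (\<Prod>k\<in>I - {i}. \<phi> k (v j k))" for j
      have \<phi>i: "\<phi> i \<in> dual_space scale (V i)"
        using True I by auto
      have upd: "\<phi>(i := \<psi>) \<in> ?D"
        using True \<psi> I by (auto simp: PiE_iff extensional_def)
      \<comment> \<open>The restriction discards \<open>\<phi> i\<close>, because
        \<open>contract\<close> is 0 at arguments that are not extensional on
        \<open>I - {i}\<close>.\<close>
      have res: "restrict \<phi> (I - {i}) \<in> (\<Pi>\<^sub>E k\<in>I - {i}. dual_space scale (V k))"
        using True by auto
      have "(restrict \<phi> (I - {i}))(i := \<psi>) = \<phi>(i := \<psi>)"
        using True I by (auto simp: fun_eq_iff PiE_iff extensional_def)
      then have "contract scale I V i \<psi> T (restrict \<phi> (I - {i})) = T (\<phi>(i := \<psi>))"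
        using res by (simp add: contract_def)
      also have "\<dots> = (\<Sum>j<R. \<psi> (v j i) * P j)"
        using upd I by (simp add: T sum_fun_apply pure_tensor_def prod.remove[of I i] P_def)
      finally have rel: "(\<Sum>j<R. \<psi> (v j i) * P j) = 0"
        using zero by simp
      have w: "pure_tensor scale I V (w j) \<phi> = \<phi> i (v j i) * P j + a j * \<phi> i (v p i) * P j"
        if "j < R" for j
      proof -
        have "\<phi> i (w j i) = \<phi> i (v j i) + a j * \<phi> i (v p i)"
          using \<phi>i v that p(1) I subspace_scale[OF V] by (simp add: dual_space_def w_def)
        moreover have "(\<Prod>k\<in>I - {i}. \<phi> k (w j k)) = P j"
          unfolding P_def by (rule prod.cong) (auto simp: w_def)
        ultimately show ?thesis
          using True I by (simp add: pure_tensor_def prod.remove[of I i] distrib_right)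
      qed
      \<comment> \<open>Since \<open>a p = - 1\<close>, the \<open>i\<close>-th vector of
        \<open>w p\<close> is 0. So the sums may run over all \<open>j < R\<close>.\<close>
      have "pure_tensor scale I V (w p) \<phi> = 0"
        using w[OF p(1)] p(2) by (simp add: a_def)
      then have "(\<Sum>j\<in>{..<R} - {p}. pure_tensor scale I V (w j)) \<phi> =
          (\<Sum>j<R. pure_tensor scale I V (w j) \<phi>)"
        using p(1) by (simp add: sum_fun_apply sum.remove[of "{..<R}" p])
      also have "\<dots> = (\<Sum>j<R. \<phi> i (v j i) * P j) + (\<Sum>j<R. a j * \<phi> i (v p i) * P j)"
        by (simp add: w sum.distrib)
      also have "(\<Sum>j<R. a j * \<phi> i (v p i) * P j) =
          - (\<phi> i (v p i) / \<psi> (v p i)) * (\<Sum>j<R. \<psi> (v j i) * P j)"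
        unfolding sum_distrib_left by (rule sum.cong) (auto simp: a_def)
      also have "(\<Sum>j<R. \<phi> i (v j i) * P j) = T \<phi>"
        using True I by (simp add: T sum_fun_apply pure_tensor_def prod.remove[of I i] P_def)
      finally show ?thesis
        using rel by simp
    qed (simp add: T sum_fun_apply pure_tensor_def)
  qed
  moreover have "w j k \<in> V k" if "j \<in> {..<R} - {p}" "k \<in> I" for j k
    using that v p(1) I subspace_add[OF V] subspace_scale[OF V] by (auto simp: w_def)
  ultimately have "tensor_rank scale I V T \<le> enat (card ({..<R} - {p}))"
    using tensor_rank_le_card[of "{..<R} - {p}" I w V scale] by simp
  also have "\<dots> < enat R"
    using p(1) by simp
  finally show False
    using R by simp
qed

text \<open>Using codeword entries as coefficients of the contracted pure tensors gives a linear map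
  from the code onto the contraction space. Minimality makes its kernel on the code trivial.\<close>

lemma dim_associated_code_minimal:
  assumes I: "finite I" "i \<in> I" and V: "subspace (V i)"
    and dec: "pure_decomposition scale I V T R v" and R: "enat R = tensor_rank scale I V T"
  shows "fun_space.dim (associated_code scale V i R v) =
    fun_space.dim (contraction_space scale I V i T)"
proof -
  let ?C = "associated_code scale V i R v"
  have T: "T = (\<Sum>j<R. pure_tensor scale I V (v j))" and v: "\<And>j k. j < R \<Longrightarrow> k \<in> I \<Longrightarrow> v j k \<in> V k"
    using dec by (auto simp: pure_decomposition_def)
  define f where "f c = (\<Sum>j<R. fun_scale (c j) (pure_tensor scale (I - {i}) V (v j)))" for c
  interpret f: Vector_Spaces.linear fun_scale fun_scale f
    by unfold_locales (auto simp: f_def fun_scale_def fun_eq_iff sum_fun_apply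
        sum.distrib sum_distrib_left algebra_simps)
  have f_codeword: "f (codeword i R v \<psi>) = contract scale I V i \<psi> T"
    if "\<psi> \<in> dual_space scale (V i)" for \<psi>
    using contract_pure_sum[of I i \<psi> scale V v "{..<R}"] I that by (simp add: f_def codeword_def T)
  have sub: "fun_space.subspace ?C"
    using linear_code_associated_code[of V i R v] V v I by (auto simp: linear_code_def)
  have "c = 0" if "c \<in> ?C" "f c = 0" for c
    using that f_codeword minimal_decomposition_contract_eq_0[of I i V T R v] assms
    by (auto simp: associated_code_eq)
  then have "inj_on f ?C"
    using f.inj_on_iff_eq_0[OF sub] by blast
  moreover have "f ` ?C = contraction_space scale I V i T"
    using f_codeword by (auto simp: associated_code_eq contraction_space_def image_iff)
  ultimately show ?thesis
    using f.dim_image_inj_on[OF sub] by simp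
qed

end

section \<open>The lower bound for the tensor rank\<close>

lemma shortest_length_le_minimal_decomposition:
  fixes scale :: "'a::{field,finite} \<Rightarrow> 'v::ab_group_add \<Rightarrow> 'v"
  assumes vs: "vector_space scale" and I: "finite I" "i \<in> I"
    and V: "\<And>k. k \<in> I \<Longrightarrow> module.subspace scale (V k)"
    and dec: "pure_decomposition scale I V T R v" and R: "enat R = tensor_rank scale I V T"
  shows "shortest_length TYPE('a) (fun_space.dim (associated_code scale V i R v))
    (min_contraction_rank scale I V i T) \<le> enat R"
proof -
  interpret vector_space scale by (rule vs)
  let ?C = "associated_code scale V i R v" and ?d = "min_contraction_rank scale I V i T"
  have v: "\<And>j k. j < R \<Longrightarrow> k \<in> I \<Longrightarrow> v j k \<in> V k"
    using dec by (auto simp: pure_decomposition_def)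
  have C: "linear_code R ?C"
    using V I v by (intro linear_code_associated_code) auto
  then have sub: "fun_space.subspace ?C"
    by (simp add: linear_code_def)
  \<comment> \<open>A zero codeword gives a zero contraction in any decomposition; the converse uses
    minimality.\<close>
  have zero_iff: "contract scale I V i \<psi> T = 0 \<longleftrightarrow> codeword i R v \<psi> = 0"
    if \<psi>: "\<psi> \<in> dual_space scale (V i)" for \<psi>
  proof
    assume "codeword i R v \<psi> = 0"
    then have "\<psi> (v j i) = 0" if "j < R" for j
      using that by (auto simp: codeword_def fun_eq_iff split: if_splits)
    then show "contract scale I V i \<psi> T = 0"
      using contract_pure_sum[of I i \<psi> scale V v "{..<R}"] I \<psi> dec by (simp add: pure_decomposition_def)
  qed (rule minimal_decomposition_contract_eq_0[OF I V[OF I(2)] dec R \<psi>])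
  show ?thesis
  proof (rule shortest_length_le[OF C min_contraction_rank_nonzero])
    show "?d \<le> min_dist R ?C"
    proof (rule le_min_dist[OF sub])
      fix x assume "x \<in> ?C" "x \<noteq> 0"
      then obtain \<psi> where "\<psi> \<in> dual_space scale (V i)" "x = codeword i R v \<psi>"
        by (auto simp: associated_code_eq)
      with \<open>x \<noteq> 0\<close> zero_iff min_contraction_rank_le_weight[OF I V dec]
      show "?d \<le> enat (hamming_dist R x 0)"
        by simp
    qed
    \<comment> \<open>A code of infinite distance is zero, so there are no nonzero contractions and
      \<open>?d\<close> is an infimum over the empty set.\<close>
    assume inf: "min_dist R ?C = \<infinity>"
    have "codeword i R v \<psi> = 0" if "\<psi> \<in> dual_space scale (V i)" for \<psi>
      using min_dist_le_hamming_dist[of "codeword i R v \<psi>" ?C 0 R] inf that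
        fun_space.subspace_0[OF sub] by (auto simp: associated_code_eq)
    then have "{tensor_rank scale (I - {i}) V S | S. S \<in> contraction_space scale I V i T \<and> S \<noteq> 0} = {}"
      using zero_iff by (auto simp: contraction_space_def)
    then show "?d = \<infinity>"
      by (simp only: min_contraction_rank_def Inf_empty top_enat_def)
  qed
qed

text \<open>The last assumption excludes decompositions with too large a code. For example, writing
  \<open>T = 0\<close> as a nonzero pure tensor plus its negative gives a code of dimension 1, while
  the minimum contraction rank is \<infinity>. No such code has that distance, so the right-hand
  side would be \<infinity> and the rank 0.\<close>

theorem theorem2:
  fixes scale :: "'a::{field,finite} \<Rightarrow> 'v::ab_group_add \<Rightarrow> 'v"
    and V :: "nat \<Rightarrow> 'v set" and t i R :: nat
    and T :: "('a, 'v) tensor" and v :: "nat \<Rightarrow> nat \<Rightarrow> 'v"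
  assumes "vector_space scale"
    and "\<And>k. k \<in> {1..t} \<Longrightarrow> module.subspace scale (V k)"
    and "\<And>k. k \<in> {1..t} \<Longrightarrow> \<exists>B. finite B \<and> V k = module.span scale B"
    and "T \<in> tensor_space scale {1..t} V"
    and "pure_decomposition scale {1..t} V T R v"
    and "i \<in> {1..t}"
    and "enat R = tensor_rank scale {1..t} V T \<or>
      fun_space.dim (associated_code scale V i R v) =
        fun_space.dim (contraction_space scale {1..t} V i T)"
  shows "tensor_rank scale {1..t} V T \<ge>
    shortest_length TYPE('a) (fun_space.dim (associated_code scale V i R v))
      (min_contraction_rank scale {1..t} V i T)"
proof -
  interpret vector_space scale by (rule assms(1))
  obtain R' v' where R': "enat R' = tensor_rank scale {1..t} V T"
    and dec': "pure_decomposition scale {1..t} V T R' v'"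
    using tensor_rank_attained[OF assms(5)] by blast
  \<comment> \<open>The contraction space depends on \<open>T\<close> alone, so its dimension links
    the given code to that of a minimal decomposition.\<close>
  have "fun_space.dim (associated_code scale V i R v) =
      fun_space.dim (contraction_space scale {1..t} V i T)"
    using assms(7) dim_associated_code_minimal[of "{1..t}" i V T R v] assms(2,5,6) by auto
  also have "\<dots> = fun_space.dim (associated_code scale V i R' v')"
    using dim_associated_code_minimal[of "{1..t}" i V T R' v'] assms(2,6) dec' R' by auto
  finally show ?thesis
    using shortest_length_le_minimal_decomposition[OF assms(1) _ assms(6) assms(2) dec' R'] R' by simp
qed

end
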